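(* Let $k\ge 2$ be an integer and $n$ a positive integer. Every graph in $G_{n,2k}$ contains no subgraph isomorphic to $L_{2k+1}$ and has exactly $\mathrm{ex}(n,L_{2k+1})$ edges; that is, the graphs in $G_{n,2k}$ are edge maximizers for $L_{2k+1}$.
   Context: For even $d$, $CP_d$ is the complement of a perfect matching in $K_d$; for odd $d$, $L_d=CP_{d-1}\vee K_1$. $\mathrm{ex}(n,F)$ is the maximum number of edges in an $n$-vertex graph with no subgraph isomorphic to $F$. The set $G_{n,2k}$ consists of all graphs obtained as follows: choose nonnegative integers $n_1,\dots,n_k$ with $\sum_i n_i=n$ such that for all $i\ne j$, $|n_i-n_j|\le 2$, and $|n_i-n_j|=2$ only when both $n_i,n_j$ are even; take the complete $k$-partite graph $K_{n_1,\dots,n_k}$ and add a maximum matching inside each part. *)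

theory Defs
  imports Main
begin

record 'a graph =
  verts :: "'a set"
  edges :: "'a set set"

definition simple_graph :: "'a graph \<Rightarrow> bool" where
  "simple_graph G \<longleftrightarrow> finite (verts G) \<and> (\<forall>e\<in>edges G. e \<subseteq> verts G \<and> card e = 2)"

definition subgraph :: "'a graph \<Rightarrow> 'a graph \<Rightarrow> bool" where
  "subgraph H G \<longleftrightarrow> simple_graph H \<and> verts H \<subseteq> verts G \<and> edges H \<subseteq> edges G"

definition isomorphic :: "'a graph \<Rightarrow> 'b graph \<Rightarrow> bool" where
  "isomorphic G H \<longleftrightarrow> (\<exists>f. bij_betw f (verts G) (verts H) \<and>
     (\<forall>u\<in>verts G. \<forall>v\<in>verts G. {u, v} \<in> edges G \<longleftrightarrow> {f u, f v} \<in> edges H))"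

text \<open>Containment of a not necessarily induced copy.\<close>

definition contains_copy :: "'a graph \<Rightarrow> 'b graph \<Rightarrow> bool" where
  "contains_copy G F \<longleftrightarrow> (\<exists>H. subgraph H G \<and> isomorphic H F)"

text \<open>
  Up to isomorphism an \<open>n\<close>-vertex graph has vertex set \<open>{..<n}\<close>. The set below is finite, and it
  is nonempty (so that \<open>Max\<close> is meaningful) as soon as \<open>F\<close> has an edge.
\<close>

definition ex_number :: "nat \<Rightarrow> 'b graph \<Rightarrow> nat" where
  "ex_number n F =
     Max {card (edges G) | G :: nat graph.
            simple_graph G \<and> verts G = {..<n} \<and> \<not> contains_copy G F}"

definition complete_graph :: "'a set \<Rightarrow> 'a graph" where
  "complete_graph V = \<lparr>verts = V, edges = {e. e \<subseteq> V \<and> card e = 2}\<rparr>"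

text \<open>The join of two graphs with disjoint vertex sets.\<close>

definition join :: "'a graph \<Rightarrow> 'a graph \<Rightarrow> 'a graph" where
  "join G H = \<lparr>verts = verts G \<union> verts H,
     edges = edges G \<union> edges H \<union> {{u, v} | u v. u \<in> verts G \<and> v \<in> verts H}\<rparr>"

definition matching :: "'a graph \<Rightarrow> 'a set set \<Rightarrow> bool" where
  "matching G M \<longleftrightarrow> M \<subseteq> edges G \<and> pairwise disjnt M"

definition maximum_matching :: "'a graph \<Rightarrow> 'a set set \<Rightarrow> bool" where
  "maximum_matching G M \<longleftrightarrow>
     matching G M \<and> (\<forall>M'. matching G M' \<longrightarrow> card M' \<le> card M)"

text \<open>
  For even \<open>d\<close>, the complement of the perfect matching \<open>01, 23, \<dots>\<close> of the complete graph on
  \<open>{..<d}\<close>; all perfect matchings give isomorphic graphs. Only used for even \<open>d\<close>.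
\<close>

definition CP :: "nat \<Rightarrow> nat graph" where
  "CP d = \<lparr>verts = {..<d},
     edges = edges (complete_graph {..<d}) - {{2 * i, 2 * i + 1} | i. i < d div 2}\<rparr>"

text \<open>Only used for odd \<open>d\<close>; the vertex of \<open>K\<^sub>1\<close> is \<open>d - 1\<close>, which is not a vertex of \<open>CP (d - 1)\<close>.\<close>

definition L :: "nat \<Rightarrow> nat graph" where
  "L d = join (CP (d - 1)) (complete_graph {d - 1})"

definition complete_multipartite :: "nat \<Rightarrow> (nat \<Rightarrow> 'a set) \<Rightarrow> 'a graph" where
  "complete_multipartite k P = \<lparr>verts = (\<Union>i\<in>{1..k}. P i),
     edges = {{u, v} | u v. \<exists>i\<in>{1..k}. \<exists>j\<in>{1..k}. i \<noteq> j \<and> u \<in> P i \<and> v \<in> P j}\<rparr>"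

text \<open>
  \<open>G_family n k\<close> is the set written \<open>G\<close> with indices \<open>n\<close> and \<open>2k\<close>, on vertices of type \<open>'a\<close>:
  \<open>s i\<close> is the prescribed size of the part \<open>P i\<close> (possibly \<open>0\<close>), and \<open>M i\<close> is the matching added
  inside it. Part sizes are compared as integers since subtraction of naturals truncates.
\<close>

definition G_family :: "nat \<Rightarrow> nat \<Rightarrow> 'a graph set" where
  "G_family n k = {G. \<exists>(s :: nat \<Rightarrow> nat) P M.
     (\<Sum>i\<in>{1..k}. s i) = n \<and>
     (\<forall>i\<in>{1..k}. \<forall>j\<in>{1..k}. i \<noteq> j \<longrightarrow>
        \<bar>int (s i) - int (s j)\<bar> \<le> 2 \<and>
        (\<bar>int (s i) - int (s j)\<bar> = 2 \<longrightarrow> even (s i) \<and> even (s j))) \<and>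
     (\<forall>i\<in>{1..k}. finite (P i) \<and> card (P i) = s i) \<and>
     (\<forall>i\<in>{1..k}. \<forall>j\<in>{1..k}. i \<noteq> j \<longrightarrow> disjnt (P i) (P j)) \<and>
     (\<forall>i\<in>{1..k}. maximum_matching (complete_graph (P i)) (M i)) \<and>
     G = \<lparr>verts = verts (complete_multipartite k P),
          edges = edges (complete_multipartite k P) \<union> (\<Union>i\<in>{1..k}. M i)\<rparr>}"

end

theory Submission
  imports Defs
begin

text \<open>
  Everything is phrased through non-edges: \<open>G\<close> contains \<open>L (r + 1)\<close>, with \<open>r = 2 * k\<close>, iff the non-edges
  inside some \<open>r + 1\<close> vertices are pairwise disjoint. In a graph without such vertices, call a set
  good if the non-edges inside it are pairwise disjoint, take a good set \<open>S\<close> of maximum size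
  \<open>d \<le> r\<close> and, among those, one with as few non-edges inside as possible. A vertex \<open>v\<close> outside \<open>S\<close>
  has at least two non-neighbours in \<open>S\<close>: with none, \<open>S \<union> {v}\<close> is good; with a single one \<open>w\<close>, either
  \<open>S \<union> {v}\<close> is good, or \<open>w\<close> lies on a non-edge inside \<open>S\<close> and \<open>S - {w} \<union> {v}\<close> is a good set of the same
  size with fewer non-edges. Deleting \<open>S\<close> and inducting gives at least \<open>2 * (\<Sum>t<n. t div r)\<close>
  non-edges. The members of the family attain this bound: their part sizes all lie in
  \<open>{2 * q..2 * q + 2}\<close> for one \<open>q\<close>, and they are \<open>L (2 * k + 1)\<close>-free because three of any \<open>2 * k + 1\<close>
  vertices share a part, where they span two intersecting non-edges.
\<close>

section \<open>Non-edges and the sums of quotients that count them\<close>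

abbreviation pairs :: "'a set \<Rightarrow> 'a set set" where
  "pairs V \<equiv> {e. e \<subseteq> V \<and> card e = 2}"

definition nonedges :: "'a graph \<Rightarrow> 'a set set" where
  "nonedges G = pairs (verts G) - edges G"

text \<open>For positive \<open>r\<close> this is the number of non-edges of the Turan graph with
  \<open>r\<close> parts on \<open>n\<close> vertices: when vertices join a smallest part one at a
  time, vertex \<open>t\<close>, counted from 0, joins a part of size
  \<open>t div r\<close>.\<close>

definition div_sum :: "nat \<Rightarrow> nat \<Rightarrow> nat" where
  "div_sum r n = (\<Sum>t<n. t div r)"

lemma finite_pairs: "finite V \<Longrightarrow> finite (pairs V)"
  by (rule finite_subset[of _ "Pow V"]) auto

text \<open>The quotient stays \<open>q\<close> on the block from \<open>q * r\<close> to
  \<open>q * r + r - 1\<close>. The sum stops before \<open>q * r + j\<close>, so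
  \<open>j = r\<close> is admissible and yields a whole block.\<close>

lemma div_sum_add:
  assumes "0 < r" "j \<le> r"
  shows "div_sum r (q * r + j) = div_sum r (q * r) + j * q"
  using assms(2)
proof (induction j)
  case (Suc j)
  then have "(q * r + j) div r = q" using assms(1) by simp
  with Suc show ?case by (simp add: div_sum_def)
qed simp

text \<open>Whole blocks are summed by induction on \<open>q\<close>, then a partial block is added.
  The equation is doubled and free of subtraction. For fixed \<open>q\<close> it is affine in
  \<open>j\<close>, up to and including \<open>j = r\<close>, which lets balanced part sizes be
  summed later.\<close>

lemma div_sum_closed_form:
  assumes "0 < r" "j \<le> r"
  shows "2 * div_sum r (q * r + j) + r * q = r * q * q + 2 * j * q"
proof -
  have "2 * div_sum r (q * r) + r * q = r * q * q"
  proof (induction q)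
    case (Suc q)
    have "div_sum r (Suc q * r) = div_sum r (q * r) + r * q"
      using div_sum_add[OF assms(1) order_refl, of q] by (simp add: add.commute)
    with Suc show ?case by (simp add: algebra_simps)
  qed (simp add: div_sum_def)
  then show ?thesis
    using div_sum_add[OF assms, of q] by (simp add: algebra_simps)
qed

text \<open>Lets the lower bound survive the deletion of \<open>d\<close> vertices: the first
  \<open>d\<close> quotients vanish, and shifting the index by \<open>d\<close>, at most
  \<open>r\<close>, raises each remaining quotient by at most 1.\<close>

lemma div_sum_shift_le:
  assumes "0 < r" "d \<le> r" "d \<le> n"
  shows "div_sum r n \<le> div_sum r (n - d) + (n - d)"
proof -
  have "div_sum r n = (\<Sum>t<d. t div r) + (\<Sum>t\<in>{d..<n}. t div r)"
    unfolding div_sum_def using assms(3)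
    by (subst sum.union_disjoint[symmetric]) (auto intro: sum.cong)
  also have "(\<Sum>t<d. t div r) = 0" using assms by simp
  also have "(\<Sum>t\<in>{d..<n}. t div r) = (\<Sum>t<n - d. (t + d) div r)"
    using sum.shift_bounds_nat_ivl[of "\<lambda>t. t div r" 0 d "n - d"] assms(3)
    by (simp add: atLeast0LessThan)
  also have "\<dots> \<le> (\<Sum>t<n - d. t div r + 1)"
  proof (rule sum_mono)
    fix t
    have "(t + d) div r \<le> (t + r) div r" using assms by (intro div_le_mono) simp
    also have "\<dots> = t div r + 1" using assms(1) div_add_self2[of r t] by simp
    finally show "(t + d) div r \<le> t div r + 1" .
  qed
  also have "\<dots> = div_sum r (n - d) + (n - d)"
    unfolding div_sum_def by (subst sum.distrib) simp
  finally show ?thesis by simp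
qed

text \<open>Divides the pairs of a part of size \<open>s\<close> into those of a maximum matching
  and the non-edges. In the induction a new vertex brings \<open>s\<close> pairs, and
  \<open>s\<close> is \<open>Suc s div 2 + s div 2\<close>.\<close>

lemma choose_2_eq_div_sum: "s choose 2 = s div 2 + 2 * div_sum 2 s"
proof (induction s)
  case (Suc s)
  have "Suc s choose 2 = s + (s choose 2)" by (simp add: numeral_2_eq_2)
  moreover have "Suc s div 2 + s div 2 = s" by presburger
  ultimately show ?case using Suc by (simp add: div_sum_def)
qed (simp add: div_sum_def)

section \<open>The lower bound on the number of non-edges\<close>

text \<open>Phrased for a set \<open>E\<close> of pairs instead of a graph, so that the induction on
  \<open>card V\<close> can pass to \<open>V - S\<close> and the pairs of \<open>E\<close> inside
  it.\<close>

lemma card_nonedges_ge: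
  assumes "finite V" "E \<subseteq> pairs V" "0 < r"
    and "\<And>S. S \<subseteq> V \<Longrightarrow> card S = Suc r \<Longrightarrow> \<not> pairwise disjnt (E \<inter> Pow S)"
  shows "2 * div_sum r (card V) \<le> card E"
  using assms
proof (induction "card V" arbitrary: V E rule: less_induct)
  case less
  note fin = \<open>finite V\<close> and E = \<open>E \<subseteq> pairs V\<close>
  have finE: "finite E" using finite_subset[OF E finite_pairs[OF fin]] .
  show ?case
  proof (cases "V = {}")
    case True
    then show ?thesis by (simp add: div_sum_def)
  next
    case False
    define good where "good S \<longleftrightarrow> S \<subseteq> V \<and> pairwise disjnt (E \<inter> Pow S)" for S
    \<comment> \<open>Goodness passes to subsets, so a larger good set would contain a good set of
      size \<open>Suc r\<close>.\<close>
    have good_le: "card S \<le> r" if "good S" for S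
    proof (rule ccontr)
      assume "\<not> card S \<le> r"
      then obtain T where "T \<subseteq> S" "card T = Suc r"
        by (meson not_less_eq_eq obtain_subset_with_card_n)
      moreover have "pairwise disjnt (E \<inter> Pow T)"
        using that \<open>T \<subseteq> S\<close> unfolding good_def by (auto intro: pairwise_subset)
      ultimately show False using less.prems(4)[of T] that unfolding good_def by auto
    qed
    obtain S0 where S0: "good S0" "\<And>T. good T \<Longrightarrow> card T \<le> card S0"
    proof -
      have "good {}" using E unfolding good_def by (auto simp: pairwise_def)
      then have "\<exists>S. good S \<and> (\<forall>T. good T \<longrightarrow> card T \<le> card S)"
        by (rule ex_has_greatest_nat[where b = "Suc r"]) (use good_le in \<open>simp add: less_Suc_eq_le\<close>)
      then show thesis using that by blast
    qed
    obtain S where "good S \<and> card S = card S0"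
      and min: "\<And>T. good T \<and> card T = card S0 \<Longrightarrow> card (E \<inter> Pow S) \<le> card (E \<inter> Pow T)"
      using ex_has_least_nat[of "\<lambda>T. good T \<and> card T = card S0" S0 "\<lambda>T. card (E \<inter> Pow T)"] S0
      by blast
    then have S: "S \<subseteq> V" "pairwise disjnt (E \<inter> Pow S)" "card S = card S0"
      by (auto simp: good_def)
    have finS: "finite S" using S(1) fin finite_subset by blast
    \<comment> \<open>A single vertex is good, so \<open>S\<close> is nonempty and
      \<open>V - S\<close> is smaller than \<open>V\<close>, as the induction requires.\<close>
    obtain v0 where "v0 \<in> V" using False by blast
    have "E \<inter> Pow {v0} = {}" using E by (fastforce simp: subset_singleton_iff)
    then have "good {v0}" using \<open>v0 \<in> V\<close> unfolding good_def by simp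
    then have cS: "0 < card S" using S0(2) S(3) by fastforce
    define nb where "nb v = {w \<in> S. {v, w} \<in> E}" for v
    have nb2: "2 \<le> card (nb v)" if v: "v \<in> V - S" for v
    proof (rule ccontr)
      assume "\<not> 2 \<le> card (nb v)"
      moreover have "finite (nb v)" using finS by (simp add: nb_def)
      ultimately obtain w where w: "nb v \<subseteq> {w}"
        by (metis One_nat_def card_le_Suc0_iff_eq empty_subsetI not_less_eq_eq
            numeral_2_eq_2 singleton_iff subset_iff)
      \<comment> \<open>\<open>w\<close> is the only possible partner of \<open>v\<close> in
        \<open>S\<close>, so \<open>{v, w}\<close> is the only pair that can be new in
        \<open>insert v S\<close>.\<close>
      have new: "e = {v, w} \<and> w \<in> S" if "e \<in> E" "e \<subseteq> insert v S" "\<not> e \<subseteq> S" for e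
      proof -
        have "card e = 2" "v \<in> e" using that E by auto
        then obtain x where "e = {v, x}" "x \<noteq> v" by (metis card_2_iff doubleton_eq_iff insertE singletonD)
        then have "x \<in> nb v" using that unfolding nb_def by auto
        then show ?thesis using w \<open>e = {v, x}\<close> nb_def by blast
      qed
      have "\<not> good (insert v S)"
        using S0(2)[of "insert v S"] v finS S(3) by auto
      then obtain e1 e2 where e: "e1 \<in> E" "e2 \<in> E" "e1 \<subseteq> insert v S" "e2 \<subseteq> insert v S"
          "e1 \<noteq> e2" "\<not> disjnt e1 e2"
        using S v unfolding good_def pairwise_def by auto
      \<comment> \<open>Two intersecting pairs cannot both lie in \<open>S\<close>, and two new
        pairs would be equal. So one of them is \<open>{v, w}\<close> and the other lies in
        \<open>S\<close>; as \<open>v\<close> is outside \<open>S\<close>, they meet in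
        \<open>w\<close>.\<close>
      obtain e where eS: "e \<in> E" "e \<subseteq> S" "w \<in> e" "w \<in> S" "{v, w} \<in> E"
      proof -
        have "\<not> (e1 \<subseteq> S \<and> e2 \<subseteq> S)" using e S(2) unfolding pairwise_def by blast
        moreover have "\<not> (\<not> e1 \<subseteq> S \<and> \<not> e2 \<subseteq> S)" using new e by metis
        ultimately consider "e1 \<subseteq> S" "e2 = {v, w}" "w \<in> S" | "e2 \<subseteq> S" "e1 = {v, w}" "w \<in> S"
          using new e by metis
        then show thesis
          by cases (use e v that[of e1] that[of e2] in \<open>auto simp: disjnt_def\<close>)
      qed
      define T where "T = insert v (S - {w})"
      \<comment> \<open>The exchange gains nothing, because the only possible new pair contains
        \<open>w\<close>, and it loses \<open>e\<close>.\<close>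
      have ET: "E \<inter> Pow T \<subseteq> E \<inter> Pow S - {e}"
      proof
        fix x assume x: "x \<in> E \<inter> Pow T"
        have "w \<noteq> v" using eS v by auto
        then have "w \<notin> x" using x unfolding T_def by auto
        moreover have "x \<subseteq> insert v S" using x unfolding T_def by auto
        ultimately show "x \<in> E \<inter> Pow S - {e}" using new[of x] x eS by auto
      qed
      have "good T" unfolding good_def
        using ET S v pairwise_subset[OF S(2)] unfolding T_def by blast
      moreover have "card T = card S"
        using eS v finS cS unfolding T_def by (simp add: card_insert_if)
      ultimately have "card (E \<inter> Pow S) \<le> card (E \<inter> Pow T)" using min S(3) by simp
      also have "\<dots> \<le> card (E \<inter> Pow S - {e})" using ET finE by (intro card_mono) auto
      also have "\<dots> < card (E \<inter> Pow S)" using eS finE by (intro card_Diff1_less) auto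
      finally show False by simp
    qed
    \<comment> \<open>The pairs of \<open>E\<close> between \<open>S\<close> and its complement.
      Each has exactly one end outside \<open>S\<close>, so sorting them by that end counts none
      twice.\<close>
    define B where "B = (\<Union>v\<in>V - S. (\<lambda>w. {v, w}) ` nb v)"
    have finnb: "finite (nb v)" for v using finS by (simp add: nb_def)
    have cB: "2 * (card V - card S) \<le> card B"
    proof -
      have "card B = (\<Sum>v\<in>V - S. card ((\<lambda>w. {v, w}) ` nb v))"
        unfolding B_def using fin finnb
        by (intro card_UN_disjoint) (auto simp: nb_def doubleton_eq_iff)
      also have "\<dots> = (\<Sum>v\<in>V - S. card (nb v))"
        by (intro sum.cong refl card_image) (auto simp: inj_on_def doubleton_eq_iff)
      also have "\<dots> \<ge> (\<Sum>v\<in>V - S. 2)" using nb2 by (intro sum_mono) auto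
      finally show ?thesis using S(1) finS by (simp add: card_Diff_subset)
    qed
    have cV: "card (V - S) = card V - card S" "card S \<le> card V"
      using S(1) finS fin by (auto simp: card_Diff_subset card_mono)
    have "2 * div_sum r (card (V - S)) \<le> card (E \<inter> Pow (V - S))"
    proof (rule less.hyps)
      show "card (V - S) < card V" using cV cS by simp
      show "E \<inter> Pow (V - S) \<subseteq> pairs (V - S)" using E by auto
      fix U assume U: "U \<subseteq> V - S" "card U = Suc r"
      then have "E \<inter> Pow (V - S) \<inter> Pow U = E \<inter> Pow U" by auto
      then show "\<not> pairwise disjnt (E \<inter> Pow (V - S) \<inter> Pow U)"
        using less.prems(4)[of U] U by auto
    qed (use fin \<open>0 < r\<close> in auto)
    moreover have "card (E \<inter> Pow (V - S)) + card B = card (E \<inter> Pow (V - S) \<union> B)"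
      using finE fin finnb by (intro card_Un_disjoint[symmetric]) (auto simp: B_def nb_def)
    moreover have "\<dots> \<le> card E"
      using finE by (intro card_mono) (auto simp: B_def nb_def)
    moreover have "div_sum r (card V) \<le> div_sum r (card V - card S) + (card V - card S)"
    proof (rule div_sum_shift_le[OF \<open>0 < r\<close> _ cV(2)])
      show "card S \<le> r" using good_le[OF S0(1)] S(3) by simp
    qed
    ultimately show ?thesis using cB unfolding cV(1) by linarith
  qed
qed

section \<open>Copies of \<open>L\<close> in terms of non-edges\<close>

text \<open>Prepares the labelling of a copy of \<open>L\<close>, whose non-adjacent pairs are the
  blocks \<open>2 * i\<close>, \<open>2 * i + 1\<close>: matched vertices are listed next to each
  other, the unmatched ones at the end in any order.\<close>

lemma enumerate_along_matching:
  assumes "finite S" "N \<subseteq> pairs S" "pairwise disjnt N"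
  shows "\<exists>f. bij_betw f {..<card S} S \<and>
    (\<forall>a<card S. \<forall>b<card S. {f a, f b} \<in> N \<longrightarrow> a div 2 = b div (2::nat))"
  using assms
proof (induction "card S" arbitrary: S N rule: less_induct)
  case less
  show ?case
  proof (cases "N = {}")
    case True
    then show ?thesis
      using ex_bij_betw_nat_finite[OF less.prems(1)] by (auto simp: atLeast0LessThan)
  next
    case False
    then obtain x y where xy: "{x, y} \<in> N" "x \<noteq> y"
      using less.prems(2) by (smt (verit) card_2_iff ex_in_conv mem_Collect_eq subset_iff)
    then have xyS: "x \<in> S" "y \<in> S" using less.prems(2) by auto
    define S' where "S' = S - {x, y}"
    have cS: "card S = Suc (Suc (card S'))"
      using xy xyS less.prems(1) unfolding S'_def
      by (metis Diff_insert2 Diff_iff card_Suc_Diff1 finite_Diff insertE singletonD)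
    have N': "e = {x, y}" if "e \<in> N" "x \<in> e \<or> y \<in> e" for e
      using pairwiseD[OF less.prems(3) that(1) xy(1)] that(2) by (auto simp: disjnt_def)
    obtain f where f: "bij_betw f {..<card S'} S'"
      "\<And>a b. a < card S' \<Longrightarrow> b < card S' \<Longrightarrow> {f a, f b} \<in> N \<Longrightarrow> a div 2 = b div 2"
    proof -
      have "\<exists>f. bij_betw f {..<card S'} S' \<and>
        (\<forall>a<card S'. \<forall>b<card S'. {f a, f b} \<in> N \<inter> Pow S' \<longrightarrow> a div 2 = b div 2)"
      proof (rule less.hyps)
        show "card S' < card S" using cS by simp
        show "finite S'" using less.prems(1) by (simp add: S'_def)
        show "N \<inter> Pow S' \<subseteq> pairs S'" using less.prems(2) by auto
        show "pairwise disjnt (N \<inter> Pow S')" using pairwise_subset[OF less.prems(3)] by blast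
      qed
      then obtain f where f: "bij_betw f {..<card S'} S'"
        "\<forall>a<card S'. \<forall>b<card S'. {f a, f b} \<in> N \<inter> Pow S' \<longrightarrow> a div 2 = b div 2" by blast
      moreover have "{f a, f b} \<subseteq> S'" if "a < card S'" "b < card S'" for a b
        using f(1) that by (auto simp: bij_betw_def)
      ultimately show thesis using that[of f] by blast
    qed
    \<comment> \<open>The chosen pair takes positions 0 and 1. Moving all others up by 2 raises
      their quotients by exactly 1, so equal quotients stay equal.\<close>
    define g where "g a = (if a = 0 then x else if a = 1 then y else f (a - 2))" for a
    have g01: "g 0 = x" "g 1 = y" by (simp_all add: g_def)
    have dom: "{..<card S} = insert 0 (insert 1 ((\<lambda>a. a + 2) ` {..<card S'}))"
    proof -
      have "a \<in> (\<lambda>a. a + 2) ` {..<card S'}" if "a < card S" "a \<noteq> 0" "a \<noteq> 1" for a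
        using that cS by (intro image_eqI[of _ _ "a - 2"]) auto
      then show ?thesis using cS by auto
    qed
    have "g ` {..<card S} = insert x (insert y ((\<lambda>a. g (a + 2)) ` {..<card S'}))"
      unfolding dom by (simp add: image_image g01[simplified])
    also have "(\<lambda>a. g (a + 2)) = f" by (simp add: g_def)
    also have "insert x (insert y (f ` {..<card S'})) = S" using f(1) xyS by (auto simp: bij_betw_def S'_def)
    finally have im: "g ` {..<card S} = S" .
    then have bij: "bij_betw g {..<card S} S"
      by (simp add: bij_betw_def eq_card_imp_inj_on)
    have "a div 2 = b div 2" if ab: "a < card S" "b < card S" "{g a, g b} \<in> N" for a b
    proof (cases "x \<in> {g a, g b} \<or> y \<in> {g a, g b}")
      case True
      then have eq: "{g a, g b} = {g 0, g 1}" unfolding g01 by (rule N'[OF ab(3)])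
      have "inj_on g {..<card S}" using bij by (simp add: bij_betw_def)
      moreover have "0 < card S" "1 < card S" using cS by auto
      ultimately have "{a, b} = {0, 1}"
        using eq ab by (auto simp: doubleton_eq_iff inj_on_eq_iff)
      then show ?thesis by (auto simp: doubleton_eq_iff)
    next
      case False
      then have "g a \<noteq> g 0" "g a \<noteq> g 1" "g b \<noteq> g 0" "g b \<noteq> g 1"
        unfolding g01 by blast+
      then have "a \<noteq> 0" "a \<noteq> 1" "b \<noteq> 0" "b \<noteq> 1" by metis+
      then have ge: "a \<ge> 2" "b \<ge> 2" by linarith+
      then have "(a - 2) div 2 = (b - 2) div 2"
        using ab f(2)[of "a - 2" "b - 2"] cS by (simp add: g_def)
      then show ?thesis using ge by (auto simp: le_iff_add)
    qed
    then show ?thesis using bij by blast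
  qed
qed

lemma div_2_cases: "m = 2 * (m div 2) \<or> m = Suc (2 * (m div 2))" for m :: nat
  by (cases "even m") (auto elim!: evenE oddE)

lemma verts_L: "verts (L (2 * k + 1)) = {..<2 * k + 1}"
  by (auto simp: L_def join_def CP_def complete_graph_def)

text \<open>The vertex of the joined \<open>K_1\<close> is \<open>2 * k\<close>. Its quotient
  \<open>k\<close> is shared by no other vertex, so one condition on blocks describes both the edges
  of \<open>CP (2 * k)\<close> and those of the join.\<close>

lemma edges_L_iff:
  "{a, b} \<in> edges (L (2 * k + 1)) \<longleftrightarrow> a < 2 * k + 1 \<and> b < 2 * k + 1 \<and> a div 2 \<noteq> b div 2"
proof -
  have *: "(\<exists>i<k. {a, b} = {2 * i, Suc (2 * i)}) \<longleftrightarrow>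
      a < 2 * k \<and> b < 2 * k \<and> a \<noteq> b \<and> a div 2 = b div 2" (is "?l \<longleftrightarrow> ?r")
  proof
    assume ?r
    then have "a div 2 < k" by auto
    moreover have "a = 2 * (a div 2) \<and> b = Suc (2 * (a div 2)) \<or> a = Suc (2 * (a div 2)) \<and> b = 2 * (a div 2)"
      using \<open>?r\<close> div_2_cases[of a] div_2_cases[of b] by auto
    then have "{a, b} = {2 * (a div 2), Suc (2 * (a div 2))}" by (simp only: doubleton_eq_iff)
    ultimately show ?l by blast
  qed (auto simp: doubleton_eq_iff)
  have "{a, b} \<in> edges (CP (2 * k)) \<longleftrightarrow>
      a < 2 * k \<and> b < 2 * k \<and> a \<noteq> b \<and> \<not> (\<exists>i<k. {a, b} = {2 * i, Suc (2 * i)})"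
    by (auto simp: CP_def complete_graph_def card_insert_if)
  also have "\<dots> \<longleftrightarrow> a < 2 * k \<and> b < 2 * k \<and> a div 2 \<noteq> b div 2" using * by auto
  finally have CP: "{a, b} \<in> edges (CP (2 * k)) \<longleftrightarrow> a < 2 * k \<and> b < 2 * k \<and> a div 2 \<noteq> b div 2" .
  have K1: "{a, b} \<notin> edges (complete_graph {2 * k})"
    by (auto simp: complete_graph_def)
  have J: "{a, b} \<in> {{u, v} | u v. u \<in> verts (CP (2 * k)) \<and> v \<in> verts (complete_graph {2 * k})}
      \<longleftrightarrow> (a < 2 * k \<and> b = 2 * k) \<or> (b < 2 * k \<and> a = 2 * k)"
    by (auto simp: CP_def complete_graph_def doubleton_eq_iff)
  have "{a, b} \<in> edges (L (2 * k + 1)) \<longleftrightarrow> (a < 2 * k \<and> b < 2 * k \<and> a div 2 \<noteq> b div 2) \<or>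
      (a < 2 * k \<and> b = 2 * k) \<or> (b < 2 * k \<and> a = 2 * k)"
    unfolding L_def join_def using CP K1 J by simp
  also have "\<dots> \<longleftrightarrow> a < 2 * k + 1 \<and> b < 2 * k + 1 \<and> a div 2 \<noteq> b div 2" by auto
  finally show ?thesis .
qed

text \<open>A copy lacks only the pairs inside its blocks, so the non-edges of \<open>G\<close> on
  its vertices lie among disjoint pairs. Conversely, disjoint non-edges can be placed into blocks by
  the preceding enumeration.\<close>

lemma contains_copy_L_iff:
  assumes G: "simple_graph G"
  shows "contains_copy G (L (2 * k + 1)) \<longleftrightarrow>
    (\<exists>S\<subseteq>verts G. card S = 2 * k + 1 \<and> pairwise disjnt (nonedges G \<inter> Pow S))"
proof
  assume "contains_copy G (L (2 * k + 1))"
  then obtain H f where H: "subgraph H G" and f: "bij_betw f (verts H) {..<2 * k + 1}"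
    and iso: "\<forall>u\<in>verts H. \<forall>v\<in>verts H. {u, v} \<in> edges H \<longleftrightarrow> {f u, f v} \<in> edges (L (2 * k + 1))"
    unfolding contains_copy_def isomorphic_def verts_L by blast
  have same: "f u div 2 = f v div 2 \<and> f u \<noteq> f v"
    if "{u, v} \<in> nonedges G \<inter> Pow (verts H)" for u v
  proof -
    have uv: "u \<in> verts H" "v \<in> verts H" "{u, v} \<notin> edges H" "u \<noteq> v"
      using that H by (auto simp: nonedges_def subgraph_def)
    moreover from uv have "f u < 2 * k + 1" "f v < 2 * k + 1" "f u \<noteq> f v"
      using f by (auto simp: bij_betw_def inj_on_eq_iff)
    ultimately show ?thesis using iso edges_L_iff by blast
  qed
  have "pairwise disjnt (nonedges G \<inter> Pow (verts H))"
  proof (rule pairwiseI, rule ccontr)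
    fix e1 e2 assume e: "e1 \<in> nonedges G \<inter> Pow (verts H)" "e2 \<in> nonedges G \<inter> Pow (verts H)"
      "e1 \<noteq> e2" "\<not> disjnt e1 e2"
    then obtain x where x: "x \<in> e1" "x \<in> e2" by (auto simp: disjnt_def)
    have "card e1 = 2" "card e2 = 2" using e by (auto simp: nonedges_def)
    then obtain y z where yz: "e1 = {x, y}" "e2 = {x, z}"
      using x by (metis card_2_iff insert_commute insertE singletonD)
    then have "f x div 2 = f y div 2 \<and> f x \<noteq> f y" "f x div 2 = f z div 2 \<and> f x \<noteq> f z"
      using same e by blast+
    \<comment> \<open>Both labels share the block of \<open>f x\<close> and differ from
      \<open>f x\<close>, and a block has only two labels.\<close>
    then have "f y = f z"
      using div_2_cases[of "f x"] div_2_cases[of "f y"] div_2_cases[of "f z"] by auto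
    moreover have "y \<in> verts H" "z \<in> verts H" using e yz by auto
    ultimately show False using f yz e(3) by (auto simp: bij_betw_def inj_on_eq_iff)
  qed
  moreover have "card (verts H) = 2 * k + 1" using bij_betw_same_card[OF f] by simp
  ultimately show "\<exists>S\<subseteq>verts G. card S = 2 * k + 1 \<and> pairwise disjnt (nonedges G \<inter> Pow S)"
    using H by (auto simp: subgraph_def)
next
  assume "\<exists>S\<subseteq>verts G. card S = 2 * k + 1 \<and> pairwise disjnt (nonedges G \<inter> Pow S)"
  then obtain S where S: "S \<subseteq> verts G" "card S = 2 * k + 1"
    "pairwise disjnt (nonedges G \<inter> Pow S)" by blast
  have finS: "finite S" using S(2) card.infinite by fastforce
  have "nonedges G \<inter> Pow S \<subseteq> pairs S" by (auto simp: nonedges_def)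
  from enumerate_along_matching[OF finS this S(3)]
  obtain f where f: "bij_betw f {..<2 * k + 1} S"
    and fN: "\<And>a b. a < 2 * k + 1 \<Longrightarrow> b < 2 * k + 1 \<Longrightarrow>
      {f a, f b} \<in> nonedges G \<inter> Pow S \<Longrightarrow> a div 2 = b div 2"
    unfolding S(2) by blast
  have fS: "f a \<in> S" if "a < 2 * k + 1" for a using f that by (auto simp: bij_betw_def)
  have inj: "f a = f b \<longleftrightarrow> a = b" if "a < 2 * k + 1" "b < 2 * k + 1" for a b
    using f that by (auto simp: bij_betw_def inj_on_eq_iff)
  \<comment> \<open>Only pairs from different blocks are kept. \<open>G\<close> may also have edges
    inside blocks, so \<open>H\<close> need not be induced.\<close>
  define H where "H = \<lparr>verts = S,
    edges = {{f a, f b} | a b. a < 2 * k + 1 \<and> b < 2 * k + 1 \<and> a div 2 \<noteq> b div 2}\<rparr>"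
  have edge: "{f a, f b} \<in> edges G" if "a < 2 * k + 1" "b < 2 * k + 1" "a div 2 \<noteq> b div 2" for a b
  proof (rule ccontr)
    assume "{f a, f b} \<notin> edges G"
    moreover have "f a \<noteq> f b" using inj that by auto
    ultimately have "{f a, f b} \<in> nonedges G \<inter> Pow S"
      using fS[of a] fS[of b] that S(1) by (auto simp: nonedges_def)
    then show False using fN that by blast
  qed
  have "subgraph H G"
    unfolding subgraph_def simple_graph_def H_def using finS S(1) edge fS inj
    by (auto simp: card_2_iff) metis+
  moreover have "isomorphic H (L (2 * k + 1))"
    unfolding isomorphic_def
  proof (intro exI conjI ballI)
    let ?g = "the_inv_into {..<2 * k + 1} f"
    show g: "bij_betw ?g (verts H) (verts (L (2 * k + 1)))"
      using bij_betw_the_inv_into[OF f] unfolding verts_L by (simp add: H_def)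
    fix u v assume "u \<in> verts H" "v \<in> verts H"
    then obtain a b where ab: "u = f a" "v = f b" "a < 2 * k + 1" "b < 2 * k + 1"
      using f by (auto simp: H_def bij_betw_def)
    then have gab: "?g u = a" "?g v = b"
      using f by (auto simp: bij_betw_def intro: the_inv_into_f_f)
    have "{f a, f b} \<in> edges H \<longleftrightarrow> a div 2 \<noteq> b div 2"
      using ab(3,4) inj by (auto simp: H_def doubleton_eq_iff)
    then show "{u, v} \<in> edges H \<longleftrightarrow> {?g u, ?g v} \<in> edges (L (2 * k + 1))"
      unfolding gab edges_L_iff unfolding ab(1,2) using ab(3,4) by simp
  qed
  ultimately show "contains_copy G (L (2 * k + 1))" unfolding contains_copy_def by blast
qed

section \<open>Counting edges through non-edges, and transfer to vertex set
  \<open>{..<n}\<close>\<close>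

lemma card_edges_plus_nonedges:
  assumes "simple_graph G"
  shows "card (edges G) + card (nonedges G) = card (verts G) choose 2"
proof -
  have fin: "finite (verts G)" and sub: "edges G \<subseteq> pairs (verts G)"
    using assms by (auto simp: simple_graph_def)
  have "card (nonedges G) = card (pairs (verts G)) - card (edges G)"
    unfolding nonedges_def
    using sub finite_subset[OF sub finite_pairs[OF fin]] by (intro card_Diff_subset)
  moreover have "card (edges G) \<le> card (pairs (verts G))"
    using sub finite_pairs[OF fin] by (rule card_mono[rotated])
  ultimately show ?thesis using n_subsets[OF fin, of 2] by simp
qed

lemma card_nonedges_ge_of_L_free:
  assumes "simple_graph G" "\<not> contains_copy G (L (2 * k + 1))" "0 < k"
  shows "2 * div_sum (2 * k) (card (verts G)) \<le> card (nonedges G)"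
  using assms contains_copy_L_iff[OF assms(1), of k]
  by (intro card_nonedges_ge) (auto simp: simple_graph_def nonedges_def)

text \<open>\<open>ex_number\<close> ranges over graphs on natural numbers, whereas members of the
  family have vertices of any type. Non-edges and their disjointness are carried along a bijection,
  so the non-edge criterion moves with them.\<close>

lemma L_free_relabelling:
  fixes G :: "'a graph"
  assumes G: "simple_graph G" "card (verts G) = n" "\<not> contains_copy G (L (2 * k + 1))"
  obtains G' :: "nat graph" where "simple_graph G'" "verts G' = {..<n}"
    "card (edges G') = card (edges G)" "\<not> contains_copy G' (L (2 * k + 1))"
proof -
  obtain g where g: "bij_betw g (verts G) {..<n}"
    using G ex_bij_betw_finite_nat[of "verts G"]
    by (auto simp: simple_graph_def atLeast0LessThan)
  have inj: "inj_on g (verts G)" and im: "g ` verts G = {..<n}"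
    using g by (auto simp: bij_betw_def)
  have sub: "edges G \<subseteq> Pow (verts G)" using G(1) by (auto simp: simple_graph_def)
  have inj2: "inj_on ((`) g) (Pow (verts G))" using inj by (simp add: inj_on_image_Pow)
  define G' where "G' = \<lparr>verts = {..<n}, edges = (`) g ` edges G\<rparr>"
  have simple: "simple_graph G'"
    using G(1) im inj by (auto simp: simple_graph_def G'_def card_image inj_on_subset)
  have "\<not> contains_copy G' (L (2 * k + 1))"
  proof
    assume "contains_copy G' (L (2 * k + 1))"
    then obtain S' where S': "S' \<subseteq> {..<n}" "card S' = 2 * k + 1"
      "pairwise disjnt (nonedges G' \<inter> Pow S')"
      using contains_copy_L_iff[OF simple] by (auto simp: G'_def)
    \<comment> \<open>The preimage is cut down to \<open>verts G\<close> because \<open>g\<close> is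
      unconstrained elsewhere.\<close>
    define S where "S = {v \<in> verts G. g v \<in> S'}"
    have "S \<subseteq> verts G" by (auto simp: S_def)
    moreover have "g ` S = g ` verts G \<inter> S'" by (auto simp: S_def)
    then have "g ` S = S'" using S'(1) im by (simp add: Int_absorb1)
    ultimately have "card S = 2 * k + 1"
      using S'(2) card_image[OF inj_on_subset[OF inj, of S]] by simp
    moreover have "pairwise disjnt (nonedges G \<inter> Pow S)"
    proof (rule pairwiseI)
      fix e1 e2 assume e: "e1 \<in> nonedges G \<inter> Pow S" "e2 \<in> nonedges G \<inter> Pow S" "e1 \<noteq> e2"
      have ne: "g ` e \<in> nonedges G' \<inter> Pow S'" if "e \<in> nonedges G \<inter> Pow S" for e
      proof -
        have e: "e \<subseteq> verts G" "card e = 2" "e \<notin> edges G" "g ` e \<subseteq> S'"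
          using that by (auto simp: nonedges_def S_def)
        then have "g ` e \<notin> edges G'"
          using inj_on_image_mem_iff[OF inj2, of e "edges G"] sub by (auto simp: G'_def)
        moreover have "card (g ` e) = 2" using e inj by (simp add: card_image inj_on_subset)
        ultimately show ?thesis using e S'(1) by (auto simp: nonedges_def G'_def)
      qed
      have "e1 \<subseteq> verts G" "e2 \<subseteq> verts G" using e by (auto simp: nonedges_def)
      then have "g ` e1 \<noteq> g ` e2" using inj_on_eq_iff[OF inj2] e(3) by blast
      then have "disjnt (g ` e1) (g ` e2)" by (rule pairwiseD[OF S'(3) ne[OF e(1)] ne[OF e(2)]])
      then show "disjnt e1 e2" by (auto simp: disjnt_def)
    qed
    ultimately show False using G(3) contains_copy_L_iff[OF G(1)] by (auto simp: S_def)
  qed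
  moreover have "card (edges G') = card (edges G)"
    using card_image[OF inj_on_subset[OF inj2 sub]] by (simp add: G'_def)
  ultimately show thesis using that[of G'] simple by (simp add: G'_def)
qed

section \<open>Maximum matchings inside a part, and balanced part sizes\<close>

lemma ex_matching_half:
  assumes "finite P"
  shows "\<exists>M\<subseteq>pairs P. pairwise disjnt M \<and> card M = card P div 2"
  using assms
proof (induction "card P" arbitrary: P rule: less_induct)
  case less
  show ?case
  proof (cases "card P < 2")
    case True
    then show ?thesis by (intro exI[of _ "{}"]) auto
  next
    case False
    then obtain T where T: "T \<subseteq> P" "card T = 2"
      by (meson not_less obtain_subset_with_card_n)
    have finT: "finite T" using T less.prems finite_subset by blast
    have c: "card (P - T) = card P - 2" using T finT by (simp add: card_Diff_subset)
    obtain M where M: "M \<subseteq> pairs (P - T)" "pairwise disjnt M" "card M = card (P - T) div 2"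
      using less.hyps[of "P - T"] less.prems c False by auto
    have "T \<noteq> {}" using T(2) by auto
    then have "T \<notin> M" using M(1) by blast
    moreover have "finite M" using M(1) finite_pairs[of "P - T"] less.prems finite_subset by blast
    ultimately have "card (insert T M) = card P div 2" using M(3) c False by simp
    moreover have "pairwise disjnt (insert T M)"
      using M(1,2) by (auto simp: pairwise_insert disjnt_def)
    ultimately show ?thesis using M(1) T by (intro exI[of _ "insert T M"]) auto
  qed
qed

text \<open>Disjoint pairs cover twice as many vertices as there are pairs, which bounds
  \<open>card M\<close> from above; comparison with the matching obtained by repeatedly splitting
  off two vertices bounds it from below.\<close>

lemma card_maximum_matching:
  assumes "finite P" "maximum_matching (complete_graph P) M"
  shows "card M = card P div 2"
proof (rule antisym)
  have M: "M \<subseteq> pairs P" "pairwise disjnt M"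
    using assms(2) by (auto simp: maximum_matching_def matching_def complete_graph_def)
  have "card (\<Union>M) = sum card M"
    using M assms(1) by (intro card_Union_disjoint) (auto intro: finite_subset)
  also have "\<dots> = (\<Sum>e\<in>M. 2)" using M(1) by (intro sum.cong) auto
  finally have "2 * card M \<le> card P"
    using card_mono[OF assms(1), of "\<Union>M"] M(1) by (auto simp: Union_least mult.commute)
  then show "card M \<le> card P div 2" by simp
  obtain M' where "M' \<subseteq> pairs P" "pairwise disjnt M'" "card M' = card P div 2"
    using ex_matching_half[OF assms(1)] by blast
  moreover from this have "matching (complete_graph P) M'"
    by (simp add: matching_def complete_graph_def)
  ultimately show "card P div 2 \<le> card M"
    using assms(2) unfolding maximum_matching_def by metis
qed

text \<open>With \<open>2 * q\<close> the smallest size rounded down to an even number, every size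
  is \<open>2 * q + j i\<close> with \<open>j i\<close> at most 2. There the closed form is affine
  in \<open>j i\<close>, so the sum depends only on the total of the \<open>j i\<close>, which is at
  most \<open>2 * card I\<close>; the closed form for \<open>2 * card I\<close> gives the same
  value.\<close>

lemma sum_div_sum_balanced:
  assumes "finite I" "I \<noteq> {}"
    and bal: "\<And>i j. i \<in> I \<Longrightarrow> j \<in> I \<Longrightarrow> i \<noteq> j \<Longrightarrow>
      \<bar>int (s i) - int (s j)\<bar> \<le> 2 \<and>
      (\<bar>int (s i) - int (s j)\<bar> = 2 \<longrightarrow> even (s i) \<and> even (s j))"
  shows "(\<Sum>i\<in>I. div_sum 2 (s i)) = div_sum (2 * card I) (\<Sum>i\<in>I. s i)"
proof -
  obtain m where m: "m \<in> I" "\<And>i. i \<in> I \<Longrightarrow> s m \<le> s i"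
    using arg_min_if_finite(1)[OF assms(1,2), of s] arg_min_least[OF assms(1,2), of _ s] by blast
  define q where "q = s m div 2"
  define j where "j i = s i - q * 2" for i
  have j: "s i = q * 2 + j i" "j i \<le> 2" if "i \<in> I" for i
  proof -
    have "q * 2 \<le> s i" using m(2)[OF that] by (simp add: q_def)
    then show "s i = q * 2 + j i" by (simp add: j_def)
    \<comment> \<open>If \<open>s m\<close> is even, it equals \<open>2 * q\<close> and a difference
      of 2 is allowed. If it is odd, it equals \<open>2 * q + 1\<close> and the difference is at
      most 1.\<close>
    have "s i \<le> q * 2 + 2"
    proof (cases "i = m")
      case False
      then have b: "\<bar>int (s i) - int (s m)\<bar> \<le> 2"
        "\<bar>int (s i) - int (s m)\<bar> = 2 \<Longrightarrow> even (s m)"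
        using bal[OF that m(1)] by auto
      have "s i \<le> s m + 2" using b(1) by linarith
      moreover have "s i = s m + 2 \<longrightarrow> even (s m)" using b(2) by simp
      ultimately show ?thesis unfolding q_def by presburger
    qed (simp add: q_def)
    then show "j i \<le> 2" by (simp add: j_def)
  qed
  define c where "c = card I"
  have "0 < c" using assms(1,2) by (simp add: c_def card_gt_0_iff)
  have sum_s: "(\<Sum>i\<in>I. s i) = q * (2 * c) + (\<Sum>i\<in>I. j i)"
    using j(1) by (simp add: sum.distrib c_def)
  have "(\<Sum>i\<in>I. j i) \<le> (\<Sum>i\<in>I. 2)" using j(2) by (rule sum_mono)
  then have "(\<Sum>i\<in>I. j i) \<le> 2 * c" by (simp add: c_def)
  then have 1: "2 * div_sum (2 * c) (\<Sum>i\<in>I. s i) + 2 * c * q =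
      2 * c * q * q + 2 * (\<Sum>i\<in>I. j i) * q"
    unfolding sum_s using \<open>0 < c\<close> by (intro div_sum_closed_form) auto
  have "(\<Sum>i\<in>I. 2 * div_sum 2 (s i) + 2 * q) = (\<Sum>i\<in>I. 2 * q * q + 2 * j i * q)"
    using j div_sum_closed_form[of 2 _ q] by (intro sum.cong) auto
  then have "2 * (\<Sum>i\<in>I. div_sum 2 (s i)) + 2 * c * q = 2 * c * q * q + 2 * (\<Sum>i\<in>I. j i) * q"
    by (simp add: sum.distrib sum_distrib_left sum_distrib_right c_def algebra_simps)
  with 1 show ?thesis by (simp add: c_def)
qed

section \<open>The members of the family\<close>

text \<open>The non-edges are the pairs inside parts that the matchings leave out. Each part
  contributes \<open>2 * div_sum 2 (s i)\<close> of them, and the balance condition turns the sum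
  into the lower bound for \<open>r = 2 * k\<close>.\<close>

lemma G_family_L_free_and_card:
  assumes "0 < k" "G \<in> G_family n k"
  shows "simple_graph G" "card (verts G) = n" "\<not> contains_copy G (L (2 * k + 1))"
    and "card (nonedges G) = 2 * div_sum (2 * k) n"
proof -
  obtain s :: "nat \<Rightarrow> nat" and P M where n: "(\<Sum>i\<in>{1..k}. s i) = n"
    and bal: "\<forall>i\<in>{1..k}. \<forall>j\<in>{1..k}. i \<noteq> j \<longrightarrow> \<bar>int (s i) - int (s j)\<bar> \<le> 2 \<and>
        (\<bar>int (s i) - int (s j)\<bar> = 2 \<longrightarrow> even (s i) \<and> even (s j))"
    and P: "\<forall>i\<in>{1..k}. finite (P i) \<and> card (P i) = s i"
    and dis: "\<forall>i\<in>{1..k}. \<forall>j\<in>{1..k}. i \<noteq> j \<longrightarrow> disjnt (P i) (P j)"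
    and max: "\<forall>i\<in>{1..k}. maximum_matching (complete_graph (P i)) (M i)"
    and G: "G = \<lparr>verts = verts (complete_multipartite k P),
          edges = edges (complete_multipartite k P) \<union> (\<Union>i\<in>{1..k}. M i)\<rparr>"
    using assms(2) unfolding G_family_def by blast
  have M: "M i \<subseteq> pairs (P i)" "pairwise disjnt (M i)" if "i \<in> {1..k}" for i
    using max that by (auto simp: maximum_matching_def matching_def complete_graph_def)
  have uniq: "i = j" if "i \<in> {1..k}" "j \<in> {1..k}" "x \<in> P i" "x \<in> P j" for i j x
    using dis that unfolding disjnt_def by blast
  have V: "verts G = (\<Union>i\<in>{1..k}. P i)" by (simp add: G complete_multipartite_def)
  have edge: "{u, v} \<in> edges G \<longleftrightarrow> (if i = j then {u, v} \<in> M i else True)"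
    if ij: "i \<in> {1..k}" "j \<in> {1..k}" "u \<in> P i" "v \<in> P j" for u v i j
  proof -
    have "{u, v} \<in> edges (complete_multipartite k P) \<longleftrightarrow> i \<noteq> j"
    proof
      assume "i \<noteq> j"
      then have "\<exists>i\<in>{1..k}. \<exists>j\<in>{1..k}. i \<noteq> j \<and> u \<in> P i \<and> v \<in> P j" using ij by blast
      then show "{u, v} \<in> edges (complete_multipartite k P)"
        unfolding complete_multipartite_def graph.simps mem_Collect_eq
        by (intro exI[of _ u] exI[of _ v] conjI refl)
    next
      assume "{u, v} \<in> edges (complete_multipartite k P)"
      then obtain u' v' i' j' where *: "{u, v} = {u', v'}" "i' \<in> {1..k}" "j' \<in> {1..k}" "i' \<noteq> j'"
        "u' \<in> P i'" "v' \<in> P j'"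
        by (auto simp: complete_multipartite_def)
      \<comment> \<open>The unordered pair can be read in two orders; in either one, disjointness of
        the parts identifies \<open>i\<close> and \<open>j\<close> with \<open>i'\<close> and
        \<open>j'\<close>.\<close>
      from *(1) consider "u = u'" "v = v'" | "u = v'" "v = u'" by (auto simp: doubleton_eq_iff)
      then show "i \<noteq> j"
      proof cases
        case 1
        then show ?thesis using uniq[of i i' u] uniq[of j j' v] ij * by blast
      next
        case 2
        then show ?thesis using uniq[of i j' u] uniq[of j i' v] ij * by blast
      qed
    qed
    moreover have "{u, v} \<in> (\<Union>l\<in>{1..k}. M l) \<longleftrightarrow> {u, v} \<in> M i" if "i = j"
    proof
      assume "{u, v} \<in> (\<Union>l\<in>{1..k}. M l)"
      then obtain l where l: "l \<in> {1..k}" "{u, v} \<in> M l" by blast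
      then have "u \<in> P l" using M(1) by blast
      then show "{u, v} \<in> M i" using uniq[of i l u] ij l by blast
    qed (use ij in blast)
    moreover have "edges G = edges (complete_multipartite k P) \<union> (\<Union>l\<in>{1..k}. M l)"
      by (simp add: G)
    ultimately show ?thesis by (simp del: UN_iff)
  qed
  show simple: "simple_graph G"
    unfolding simple_graph_def
  proof (intro conjI ballI)
    show "finite (verts G)" using P V by auto
    fix e assume "e \<in> edges G"
    then consider i where "i \<in> {1..k}" "e \<in> M i" | "e \<in> edges (complete_multipartite k P)"
      by (auto simp: G)
    then have "e \<subseteq> verts G \<and> card e = 2"
    proof cases
      case 1 then show ?thesis using M(1) V by blast
    next
      case 2
      then obtain u v i j where "i \<in> {1..k}" "j \<in> {1..k}" "i \<noteq> j" "e = {u, v}" "u \<in> P i" "v \<in> P j"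
        by (auto simp: complete_multipartite_def)
      moreover from this have "u \<noteq> v" using uniq by blast
      ultimately show ?thesis using V by auto
    qed
    then show "e \<subseteq> verts G" "card e = 2" by auto
  qed
  have nonedge: "nonedges G = (\<Union>i\<in>{1..k}. pairs (P i) - M i)"
  proof (intro equalityI subsetI)
    fix e assume e: "e \<in> nonedges G"
    then obtain u v where uv: "e = {u, v}" "u \<noteq> v" by (auto simp: nonedges_def card_2_iff)
    then obtain i j where ij: "i \<in> {1..k}" "j \<in> {1..k}" "u \<in> P i" "v \<in> P j"
      using e V by (auto simp: nonedges_def)
    then have "i = j" "{u, v} \<notin> M i" using e edge[OF ij] uv by (auto simp: nonedges_def split: if_splits)
    then show "e \<in> (\<Union>i\<in>{1..k}. pairs (P i) - M i)" using uv ij by (intro UN_I[of i]) auto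
  next
    fix e assume "e \<in> (\<Union>i\<in>{1..k}. pairs (P i) - M i)"
    then obtain i where i: "i \<in> {1..k}" "e \<subseteq> P i" "card e = 2" "e \<notin> M i" by blast
    then obtain u v where uv: "e = {u, v}" "u \<noteq> v" by (auto simp: card_2_iff)
    then have "e \<notin> edges G" using edge[of i i u v] i by auto
    then show "e \<in> nonedges G" using i V by (auto simp: nonedges_def)
  qed
  show card_V: "card (verts G) = n"
    unfolding V using P dis n
    by (subst card_UN_disjoint) (auto simp: disjnt_def)
  have "card (nonedges G) = (\<Sum>i\<in>{1..k}. card (pairs (P i) - M i))"
    unfolding nonedge
  proof (rule card_UN_disjoint)
    show "\<forall>i\<in>{1..k}. finite (pairs (P i) - M i)" using P finite_pairs by blast
    show "\<forall>i\<in>{1..k}. \<forall>j\<in>{1..k}. i \<noteq> j \<longrightarrow> (pairs (P i) - M i) \<inter> (pairs (P j) - M j) = {}"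
    proof (intro ballI impI equals0I)
      fix i j e assume ij: "i \<in> {1..k}" "j \<in> {1..k}" "i \<noteq> j"
        and e: "e \<in> (pairs (P i) - M i) \<inter> (pairs (P j) - M j)"
      then obtain x where "x \<in> e" by (auto simp: card_2_iff)
      then show False using uniq[of i j x] ij e by blast
    qed
  qed simp
  also have "\<dots> = (\<Sum>i\<in>{1..k}. 2 * div_sum 2 (s i))"
  proof (rule sum.cong)
    fix i assume i: "i \<in> {1..k}"
    have Pi: "finite (P i)" "card (P i) = s i" using P i by blast+
    then have "card (M i) = s i div 2"
      using card_maximum_matching[of "P i" "M i"] max i by simp
    then have "card (pairs (P i) - M i) = (s i choose 2) - s i div 2"
      using Pi M(1)[OF i] n_subsets[OF Pi(1), of 2] finite_subset[OF M(1)[OF i] finite_pairs]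
      by (simp add: card_Diff_subset)
    then show "card (pairs (P i) - M i) = 2 * div_sum 2 (s i)"
      using choose_2_eq_div_sum[of "s i"] by simp
  qed simp
  also have "\<dots> = 2 * div_sum (2 * k) n"
    using sum_div_sum_balanced[of "{1..k}" s] bal assms(1) n
    by (simp add: sum_distrib_left[symmetric])
  finally show "card (nonedges G) = 2 * div_sum (2 * k) n" .
  show "\<not> contains_copy G (L (2 * k + 1))"
  proof
    assume "contains_copy G (L (2 * k + 1))"
    then obtain S where S: "S \<subseteq> verts G" "card S = 2 * k + 1"
      "pairwise disjnt (nonedges G \<inter> Pow S)"
      using contains_copy_L_iff[OF simple] by blast
    have "\<exists>i\<in>{1..k}. 2 < card (S \<inter> P i)"
    proof (rule ccontr)
      assume "\<not> (\<exists>i\<in>{1..k}. 2 < card (S \<inter> P i))"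
      then have "(\<Sum>i\<in>{1..k}. card (S \<inter> P i)) \<le> (\<Sum>i\<in>{1..k}. 2)"
        by (intro sum_mono) (auto simp: not_less)
      moreover have "card S \<le> (\<Sum>i\<in>{1..k}. card (S \<inter> P i))"
        using card_UN_le[of "{1..k}" "\<lambda>i. S \<inter> P i"] S(1) V
        by (simp add: Int_UN_distrib[symmetric] Int_absorb2)
      ultimately show False using S(2) by simp
    qed
    then obtain i T where i: "i \<in> {1..k}" and T: "T \<subseteq> S \<inter> P i" "card T = 3"
      using obtain_subset_with_card_n[of 3] by (metis Suc_leI eval_nat_numeral(3))
    then obtain a b c where abc: "T = {a, b, c}" "a \<noteq> b" "b \<noteq> c" "a \<noteq> c"
      by (auto simp: card_3_iff)
    have mem: "e \<in> M i \<or> e \<in> nonedges G \<inter> Pow S" if "e \<in> {{a, b}, {b, c}, {a, c}}" for e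
      using that abc T i unfolding nonedge by (auto intro!: bexI[of _ i])
    \<comment> \<open>Any two sides of the triangle \<open>a\<close>, \<open>b\<close>,
      \<open>c\<close> meet. The matching \<open>M i\<close> and the non-edges inside
      \<open>S\<close> are both pairwise disjoint, so each holds at most one side, yet together they
      hold all three.\<close>
    have "\<not> disjnt {a, b} {b, c}" "\<not> disjnt {a, b} {a, c}" "\<not> disjnt {b, c} {a, c}"
      "{a, b} \<noteq> {b, c}" "{a, b} \<noteq> {a, c}" "{b, c} \<noteq> {a, c}"
      using abc by (auto simp: doubleton_eq_iff)
    moreover have "\<not> (e \<in> M i \<and> e' \<in> M i)" "\<not> (e \<in> nonedges G \<inter> Pow S \<and> e' \<in> nonedges G \<inter> Pow S)"
      if "e \<noteq> e'" "\<not> disjnt e e'" for e e'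
      using pairwiseD[OF S(3), of e e'] pairwiseD[OF M(2)[OF i], of e e'] that by blast+
    moreover have "{a, b} \<in> M i \<or> {a, b} \<in> nonedges G \<inter> Pow S"
      "{b, c} \<in> M i \<or> {b, c} \<in> nonedges G \<inter> Pow S"
      "{a, c} \<in> M i \<or> {a, c} \<in> nonedges G \<inter> Pow S"
      by (rule mem; simp)+
    ultimately show False by metis
  qed
qed

section \<open>Comparison with the extremal number\<close>

theorem theorem3p4:
  fixes n k :: nat and G :: "'a graph"
  assumes "k \<ge> 2" and "n > 0"
    and "G \<in> G_family n k"
  shows "\<not> contains_copy G (L (2 * k + 1)) \<and>
         card (edges G) = ex_number n (L (2 * k + 1))"
proof -
  have "0 < k" using assms(1) by simp
  note G = G_family_L_free_and_card[OF this assms(3)]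
  let ?A = "{card (edges H) | H :: nat graph.
    simple_graph H \<and> verts H = {..<n} \<and> \<not> contains_copy H (L (2 * k + 1))}"
  \<comment> \<open>Edges and non-edges together number \<open>n choose 2\<close> in both graphs,
    and \<open>G\<close> has the fewest non-edges possible. This bound also makes \<open>?A\<close>
    finite, so that its \<open>Max\<close> can be evaluated.\<close>
  have le: "m \<le> card (edges G)" if "m \<in> ?A" for m
  proof -
    obtain H :: "nat graph" where H: "m = card (edges H)" "simple_graph H" "verts H = {..<n}"
      "\<not> contains_copy H (L (2 * k + 1))" using \<open>m \<in> ?A\<close> by auto
    show ?thesis
      using card_nonedges_ge_of_L_free[OF H(2,4) \<open>0 < k\<close>] card_edges_plus_nonedges[OF H(2)]
        card_edges_plus_nonedges[OF G(1)] G(2,4) H(1,3) by simp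
  qed
  \<comment> \<open>The relabelled copy of \<open>G\<close> on \<open>{..<n}\<close> attains the
    bound.\<close>
  have "card (edges G) \<in> ?A"
    using L_free_relabelling[OF G(1-3)] by (smt (verit) mem_Collect_eq)
  moreover have "finite ?A" using le by (meson finite_nat_set_iff_bounded_le)
  ultimately have "ex_number n (L (2 * k + 1)) = card (edges G)"
    unfolding ex_number_def using le by (intro Max_eqI)
  with G(3) show ?thesis by simp
qed

end
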